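(* For every fixed real number $0<c<1/4$ there exists $n_0$ such that for all integers $n\ge n_0$, \[ |\mathcal T_n|\ge \exp(c\,n\log n), \] where $\mathcal T_n=\{\tau(G): G \text{ is a simple graph on } n \text{ vertices}\}$ and $\tau(G)$ denotes the number of spanning trees of $G$.
   Context: For a finite graph $G$, $\tau(G)$ denotes the number of spanning trees of $G$. $\log$ is the natural logarithm. *)

theory Defs
  imports Complex_Main "HOL-Library.Ramsey"
begin

text \<open>
  A graph is given by its vertex set \<open>V\<close> and its set \<open>E\<close> of edges, an edge being the
  two-element set of its endpoints. \<open>HOL-Library.Ramsey\<close>'s \<open>nsets V 2\<close> is the set of
  two-element subsets of \<open>V\<close>.
\<close>

definition simple_graph :: "'a set \<Rightarrow> 'a set set \<Rightarrow> bool" where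
  "simple_graph V E \<longleftrightarrow> finite V \<and> E \<subseteq> nsets V 2"

definition connected_graph :: "'a set \<Rightarrow> 'a set set \<Rightarrow> bool" where
  "connected_graph V E \<longleftrightarrow>
     V \<noteq> {} \<and> (\<forall>u\<in>V. \<forall>v\<in>V. (u, v) \<in> {(x, y). {x, y} \<in> E}\<^sup>*)"

text \<open>The list enumerates the vertices of the cycle once each; the index wraps around.\<close>

definition graph_cycle :: "'a set set \<Rightarrow> 'a list \<Rightarrow> bool" where
  "graph_cycle E p \<longleftrightarrow>
     length p \<ge> 3 \<and> distinct p \<and>
     (\<forall>i<length p. {p ! i, p ! (Suc i mod length p)} \<in> E)"

definition tree_graph :: "'a set \<Rightarrow> 'a set set \<Rightarrow> bool" where
  "tree_graph V E \<longleftrightarrow> simple_graph V E \<and> connected_graph V E \<and> \<not> (\<exists>p. graph_cycle E p)"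

text \<open>A spanning tree has the same vertex set as the graph, so it is determined by its edges.\<close>

definition spanning_trees :: "'a set \<Rightarrow> 'a set set \<Rightarrow> 'a set set set" where
  "spanning_trees V E = {F. F \<subseteq> E \<and> tree_graph V F}"

definition tau :: "'a set \<Rightarrow> 'a set set \<Rightarrow> nat" where
  "tau V E = card (spanning_trees V E)"

text \<open>
  Vertices are natural numbers without loss of generality: every finite graph is isomorphic
  to one of these.
\<close>

definition tau_values :: "nat \<Rightarrow> nat set" where
  "tau_values n = {tau V E | (V :: nat set) E. simple_graph V E \<and> card V = n}"

text \<open>The set is finite, so \<open>card (tau_values n)\<close> is its actual size.\<close>

lemma finite_tau_values: "finite (tau_values n)"
proof (rule finite_subset)
  show "tau_values n \<subseteq> {..2 ^ (n choose 2)}"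
  proof
    fix t assume "t \<in> tau_values n"
    then obtain V :: "nat set" and E
      where t: "t = tau V E" and V: "finite V" "card V = n" and E: "E \<subseteq> nsets V 2"
      by (auto simp: tau_values_def simple_graph_def)
    have fin: "finite (nsets V 2)"
      using V by (simp add: finite_imp_finite_nsets)
    have "spanning_trees V E \<subseteq> Pow (nsets V 2)"
      using E by (auto simp: spanning_trees_def)
    then have "card (spanning_trees V E) \<le> card (Pow (nsets V 2))"
      using fin by (intro card_mono) auto
    also have "\<dots> = 2 ^ (n choose 2)"
      using fin V by (simp add: card_Pow)
    finally show "t \<in> {..2 ^ (n choose 2)}"
      by (simp add: t tau_def)
  qed
qed simp

end

theory Submission
  imports
    Defs
    "HOL-Library.Transitive_Closure_Table"
    "HOL-Computational_Algebra.Primes"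
    "HOL-Real_Asymp.Real_Asymp"
    "Jordan_Normal_Form.Determinant"
begin

text \<open>
  Take two copies of a path on \<open>k\<close> vertices and \<open>n - 2 * k\<close> further vertices, one of which (the
  root) is adjacent to everything; join the \<open>i\<close>-th vertices of both paths to the same set of
  further vertices, of any prescribed size. Exchanging the copies is an automorphism, and on
  antisymmetric vectors the further vertices behave as if contracted to the root. Hence the
  reduced Laplacian determinant is divisible by the continuant of the degree sequence
  \<open>d\<^sub>1, \<dots>, d\<^sub>k\<close>, where the \<open>d\<^sub>i\<close> range freely over about \<open>n - 2 * k\<close> values.
  The sequence is determined by two continuants, those of \<open>d\<^sub>1, \<dots>, d\<^sub>k\<close> and of
  \<open>d\<^sub>2, \<dots>, d\<^sub>k\<close>, which both divide positive elements of \<open>tau_values n\<close>. A positive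
  integer that is at most \<open>n ^ n\<close> has only \<open>exp (O n)\<close> divisors, so
  \<open>(n - 2 * k) ^ k \<le> (card (tau_values n) * exp (O n))\<^sup>2\<close> up to lower order terms. Letting \<open>k\<close>
  be slightly below \<open>n / 2\<close> gives every constant below \<open>1 / 4\<close>.
\<close>

subsection \<open>Spanning trees as parent maps\<close>

definition parent_edges :: "'a set \<Rightarrow> 'a \<Rightarrow> ('a \<Rightarrow> 'a) \<Rightarrow> 'a set set" where
  "parent_edges V r f = (\<lambda>v. {v, f v}) ` (V - {r})"

text \<open>The extensional function space makes a map determined by its values off the root, so
  counting maps counts trees. The value at \<open>r\<close> is \<open>undefined\<close>; hence the
  condition asks only that some iterate equals \<open>r\<close>, not that iterates stay
  there.\<close>

definition parent_maps :: "'a set \<Rightarrow> 'a \<Rightarrow> 'a set set \<Rightarrow> ('a \<Rightarrow> 'a) set" where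
  "parent_maps V r E =
     {f \<in> (V - {r}) \<rightarrow>\<^sub>E V. (\<forall>v\<in>V - {r}. {v, f v} \<in> E) \<and> (\<forall>v\<in>V. \<exists>t. (f ^^ t) v = r)}"

text \<open>Depth, the number of steps to the root, drops by one along each parent edge, which gives
  connectivity. On a cycle, both neighbours of a vertex of maximal depth would have to be its
  parent.\<close>

lemma parent_edges_parent_maps:
  assumes "simple_graph V E" "r \<in> V" "f \<in> parent_maps V r E"
  shows "parent_edges V r f \<in> spanning_trees V E"
proof -
  have fV: "f v \<in> V" and fE: "{v, f v} \<in> E" if "v \<in> V" "v \<noteq> r" for v
    using assms(3) that by (auto simp: parent_maps_def)
  have reach: "\<exists>t. (f ^^ t) v = r" if "v \<in> V" for v
    using assms(3) that by (auto simp: parent_maps_def)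
  let ?F = "parent_edges V r f"
  define dep where "dep v = (LEAST t. (f ^^ t) v = r)" for v
  have dep: "dep v = Suc (dep (f v))" if v: "v \<in> V" "v \<noteq> r" for v
  proof -
    obtain t where "(f ^^ t) v = r" using reach[OF v(1)] by blast
    then have "(LEAST t. (f ^^ t) v = r) = Suc (LEAST t. (f ^^ Suc t) v = r)"
      by (rule Least_Suc) (use v in simp)
    then show ?thesis by (simp add: dep_def funpow_swap1)
  qed
  have FE: "?F \<subseteq> E" using fE by (auto simp: parent_edges_def)
  let ?R = "{(x, y). {x, y} \<in> ?F}"
  have to_root: "(v, r) \<in> ?R\<^sup>*" if "v \<in> V" for v
    using that
  proof (induction "dep v" arbitrary: v)
    case 0
    then show ?case using dep by (cases "v = r") auto
  next
    case (Suc k)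
    show ?case
    proof (cases "v = r")
      case False
      have "(v, f v) \<in> ?R" using False Suc.prems by (auto simp: parent_edges_def)
      moreover have "(f v, r) \<in> ?R\<^sup>*"
        using Suc dep[OF Suc.prems False] fV[OF Suc.prems False] by simp
      ultimately show ?thesis by (rule converse_rtrancl_into_rtrancl)
    qed simp
  qed
  have "sym ?R" by (auto simp: sym_def insert_commute)
  then have "sym (?R\<^sup>*)" by (rule sym_rtrancl)
  then have "(u, v) \<in> ?R\<^sup>*" if "u \<in> V" "v \<in> V" for u v
    using to_root[OF that(1)] to_root[OF that(2)] by (meson rtrancl_trans symE)
  then have conn: "connected_graph V ?F" using assms(2) by (auto simp: connected_graph_def)
  have "\<not> graph_cycle ?F p" for p
  proof
    assume "graph_cycle ?F p"
    then have len: "length p \<ge> 3" and dist: "distinct p"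
      and edge: "\<And>i. i < length p \<Longrightarrow> {p ! i, p ! (Suc i mod length p)} \<in> ?F"
      by (auto simp: graph_cycle_def)
    let ?D = "(\<lambda>i. dep (p ! i)) ` {..<length p}"
    have "{..<length p} \<noteq> {}" using len by (auto simp: lessThan_empty_iff)
    then have "Max ?D \<in> ?D" by (intro Max_in) auto
    then obtain i where il: "i < length p" and "dep (p ! i) = Max ?D" by auto
    then have imax: "dep (p ! j) \<le> dep (p ! i)" if "j < length p" for j
      using that by simp
    have nb: "p ! j = f (p ! i)" if "j < length p" "{p ! i, p ! j} \<in> ?F" for j
    proof -
      obtain v where v: "v \<in> V" "v \<noteq> r" "{p ! i, p ! j} = {v, f v}"
        using \<open>{p ! i, p ! j} \<in> ?F\<close> by (auto simp: parent_edges_def)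
      then show ?thesis using dep[OF v(1,2)] imax[OF that(1)]
        by (auto simp: doubleton_eq_iff)
    qed
    \<comment> \<open>The cyclic predecessor of position \<open>i\<close>; it differs from the
      successor \<open>?k\<close> because cycles have length at least 3.\<close>
    define j where "j = (if i = 0 then length p - 1 else i - 1)"
    have jl: "j < length p" and ji: "Suc j mod length p = i"
      using il len by (auto simp: j_def)
    let ?k = "Suc i mod length p"
    have kl: "?k < length p" using len by (intro mod_less_divisor) linarith
    have "p ! ?k = f (p ! i)" by (rule nb[OF kl edge[OF il]])
    moreover have "p ! j = f (p ! i)"
      using nb[OF jl] edge[OF jl] ji by (simp add: insert_commute)
    ultimately have "p ! ?k = p ! j" by simp
    then have "?k = j" using dist kl jl nth_eq_iff_index_eq by blast
    then show False using il len by (cases "Suc i = length p") (auto simp: j_def split: if_splits)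
  qed
  then show ?thesis
    using conn FE assms(1) by (auto simp: spanning_trees_def tree_graph_def simple_graph_def)
qed

text \<open>If \<open>f\<close> and \<open>g\<close> differ at \<open>v\<close>, the edge from
  \<open>v\<close> to \<open>f v\<close> must be the \<open>g\<close>-edge of \<open>f v\<close>.
  Then \<open>f (f v)\<close> is not \<open>v\<close>, as otherwise \<open>f\<close> would alternate
  forever and miss the root. So the disagreement moves on to \<open>f v\<close>, and along an orbit
  that never meets \<open>r\<close>.\<close>

lemma inj_on_parent_edges: "inj_on (parent_edges V r) (parent_maps V r E)"
proof (rule inj_onI, rule ccontr)
  fix f g assume f: "f \<in> parent_maps V r E" and g: "g \<in> parent_maps V r E"
    and eq: "parent_edges V r f = parent_edges V r g" and "f \<noteq> g"
  have fe: "f \<in> (V - {r}) \<rightarrow>\<^sub>E V" and ge: "g \<in> (V - {r}) \<rightarrow>\<^sub>E V"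
    using f g by (auto simp: parent_maps_def)
  have fV: "f v \<in> V" if "v \<in> V" "v \<noteq> r" for v using fe that by auto
  have reach: "\<exists>t. (f ^^ t) v = r" if "v \<in> V" for v
    using f that by (auto simp: parent_maps_def)
  obtain v0 where "f v0 \<noteq> g v0" using \<open>f \<noteq> g\<close> by auto
  then have v0: "v0 \<in> V - {r}" using fe ge by (metis PiE_arb)
  have step: "f v \<in> V - {r} \<and> f (f v) \<noteq> g (f v)" if v: "v \<in> V - {r}" "f v \<noteq> g v" for v
  proof -
    have "{v, f v} \<in> parent_edges V r g" using v eq by (auto simp: parent_edges_def)
    then obtain u where u: "u \<in> V - {r}" "{v, f v} = {u, g u}"
      by (auto simp: parent_edges_def)
    then have uv: "u = f v" "g u = v" using v(2) by (auto simp: doubleton_eq_iff)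
    have "f u \<noteq> v"
    proof
      assume fu: "f u = v"
      obtain t where t: "(f ^^ t) v = r" using reach v by blast
      have "(f ^^ t) v \<in> {u, v}" by (induction t) (use fu uv in auto)
      then show False using t u v by auto
    qed
    then show ?thesis using u uv by auto
  qed
  obtain t where t: "(f ^^ t) v0 = r" using reach v0 by blast
  have "(f ^^ t) v0 \<in> V - {r} \<and> f ((f ^^ t) v0) \<noteq> g ((f ^^ t) v0)"
    by (induction t) (use step v0 \<open>f v0 \<noteq> g v0\<close> in auto)
  then show False using t by simp
qed

text \<open>Sending each vertex to a neighbour closer to the root gives a parent map. Its edges
  already connect everything, so any further edge of \<open>F\<close> would close a cycle.\<close>

lemma spanning_trees_subset_parent_edges:
  assumes "r \<in> V" "F \<in> spanning_trees V E"
  shows "F \<in> parent_edges V r ` parent_maps V r E"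
proof -
  have FE: "F \<subseteq> E" and FV: "F \<subseteq> nsets V 2" and conn: "connected_graph V F"
    and acyc: "\<And>p. \<not> graph_cycle F p"
    using assms(2) by (auto simp: spanning_trees_def tree_graph_def simple_graph_def)
  let ?R = "{(x, y). {x, y} \<in> F}"
  \<comment> \<open>The distance from \<open>v\<close> to the root inside \<open>F\<close>.\<close>
  define d where "d v = (LEAST k. (v, r) \<in> ?R ^^ k)" for v
  have ex: "\<exists>u. {v, u} \<in> F \<and> d u < d v" if v: "v \<in> V - {r}" for v
  proof -
    have "(v, r) \<in> ?R\<^sup>*" using conn v assms(1) by (auto simp: connected_graph_def)
    then obtain k where "(v, r) \<in> ?R ^^ k" by (auto dest: rtrancl_imp_relpow)
    then have dv: "(v, r) \<in> ?R ^^ d v" unfolding d_def by (rule LeastI)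
    show ?thesis
    proof (cases "d v")
      case 0
      then show ?thesis using dv v by simp
    next
      case (Suc k)
      then obtain u where "{v, u} \<in> F" "(u, r) \<in> ?R ^^ k"
        using dv by (metis (no_types, lifting) case_prodD mem_Collect_eq relpow_Suc_D2)
      moreover from this have "d u \<le> k" unfolding d_def by (intro Least_le)
      ultimately show ?thesis using Suc by auto
    qed
  qed
  then obtain f0 where f0: "\<And>v. v \<in> V - {r} \<Longrightarrow> {v, f0 v} \<in> F \<and> d (f0 v) < d v"
    by metis
  define f where "f = restrict f0 (V - {r})"
  have fF: "{v, f v} \<in> F" and fd: "d (f v) < d v" if "v \<in> V - {r}" for v
    using f0[OF that] that by (auto simp: f_def)
  have fV: "f v \<in> V" if "v \<in> V - {r}" for v
    using subsetD[OF FV fF[OF that]] by simp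
  have reach: "\<exists>t. (f ^^ t) v = r" if "v \<in> V" for v
    using that
  proof (induction "d v" arbitrary: v rule: less_induct)
    case less
    show ?case
    proof (cases "v = r")
      case True
      then have "(f ^^ 0) v = r" by simp
      then show ?thesis by blast
    next
      case False
      then obtain t where "(f ^^ t) (f v) = r"
        using less fd fV by blast
      then have "(f ^^ Suc t) v = r" by (simp add: funpow_swap1)
      then show ?thesis by blast
    qed
  qed
  have fin: "f \<in> parent_maps V r F"
    using fV fF reach by (auto simp: parent_maps_def f_def)
  have sg: "simple_graph V F" using assms(2) by (auto simp: spanning_trees_def tree_graph_def)
  let ?G = "parent_edges V r f"
  have "?G \<in> spanning_trees V F" by (rule parent_edges_parent_maps[OF sg assms(1) fin])
  then have GF: "?G \<subseteq> F" and Gc: "connected_graph V ?G"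
    by (auto simp: spanning_trees_def tree_graph_def)
  have "F \<subseteq> ?G"
  proof (rule ccontr)
    assume "\<not> F \<subseteq> ?G"
    then obtain e where e: "e \<in> F" "e \<notin> ?G" by auto
    then obtain x y where xy: "e = {x, y}" "x \<in> V" "y \<in> V" "x \<noteq> y"
      using FV by (metis nsets2_E subsetD)
    let ?r = "\<lambda>x y. {x, y} \<in> ?G"
    have "(x, y) \<in> {(x, y). {x, y} \<in> ?G}\<^sup>*"
      using Gc xy by (auto simp: connected_graph_def)
    then have "?r\<^sup>*\<^sup>* x y" by (simp add: rtrancl_def)
    then obtain xs where xs: "rtrancl_path ?r x xs y"
      by (auto simp: rtranclp_eq_rtrancl_path)
    then obtain xs where xs: "rtrancl_path ?r x xs y" "distinct (x # xs)"
      by (rule rtrancl_path_distinct)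
    have "xs \<noteq> []" using xs(1) xy(4) by (auto elim: rtrancl_path.cases)
    then have last: "last xs = y" using rtrancl_path_last[OF xs(1)] by simp
    have nth: "{(x # xs) ! i, xs ! i} \<in> ?G" if "i < length xs" for i
      using rtrancl_path_nth[OF xs(1) that] .
    have len: "length xs \<ge> 2"
    proof (rule ccontr)
      assume "\<not> length xs \<ge> 2"
      then obtain z where "xs = [z]" using \<open>xs \<noteq> []\<close>
        by (cases xs; cases "tl xs") auto
      then show False using nth[of 0] last e xy by simp
    qed
    have "graph_cycle F (x # xs)" unfolding graph_cycle_def
    proof (intro conjI allI impI)
      fix i assume i: "i < length (x # xs)"
      show "{(x # xs) ! i, (x # xs) ! (Suc i mod length (x # xs))} \<in> F"
      proof (cases "i < length xs")
        case True
        then show ?thesis using nth GF by auto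
      next
        case False
        then have "i = length xs" using i by simp
        moreover have "(x # xs) ! length xs = y" using last \<open>xs \<noteq> []\<close> by (simp add: last_conv_nth)
        ultimately show ?thesis using e xy by (simp add: insert_commute)
      qed
    qed (use xs len in auto)
    then show False using acyc by blast
  qed
  then have "F = ?G" using GF by blast
  moreover have "f \<in> parent_maps V r E" using fin FE by (auto simp: parent_maps_def)
  ultimately show ?thesis by blast
qed

lemma tau_eq_card_parent_maps:
  assumes "simple_graph V E" "r \<in> V"
  shows "tau V E = card (parent_maps V r E)"
proof -
  have "parent_edges V r ` parent_maps V r E = spanning_trees V E"
    using parent_edges_parent_maps[OF assms] spanning_trees_subset_parent_edges[OF assms(2)] by blast
  then show ?thesis unfolding tau_def
    using card_image[OF inj_on_parent_edges[of V r E]] by simp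
qed

lemma tau_le_power:
  assumes "simple_graph V E" "r \<in> V"
  shows "tau V E \<le> card V ^ card V"
proof -
  have fin: "finite V" using assms by (simp add: simple_graph_def)
  have "tau V E \<le> card ((V - {r}) \<rightarrow>\<^sub>E V)"
    unfolding tau_eq_card_parent_maps[OF assms]
    using fin by (intro card_mono finite_PiE) (auto simp: parent_maps_def)
  also have "\<dots> = card V ^ (card V - 1)"
    using fin assms by (simp add: card_PiE)
  also have "\<dots> \<le> card V ^ card V"
    using fin assms by (intro power_increasing) (auto simp: Suc_le_eq card_gt_0_iff)
  finally show ?thesis .
qed

subsection \<open>The matrix-tree theorem\<close>

lemma permutes_less_nat: "p permutes {0..<n} \<Longrightarrow> i < n \<Longrightarrow> p i < (n :: nat)"
  using permutes_in_image[of p "{0..<n}" i] by simp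

text \<open>The Laplacian of a graph on \<open>{..n}\<close> without the row and column of
  \<open>n\<close>; the neighbour \<open>n\<close> still counts towards the degrees.\<close>

definition reduced_laplacian :: "nat \<Rightarrow> nat set set \<Rightarrow> int mat" where
  "reduced_laplacian n E = mat n n (\<lambda>(i, j).
     if i = j then int (card {u. u \<le> n \<and> {i, u} \<in> E}) else if {i, j} \<in> E then - 1 else 0)"

text \<open>Row \<open>i\<close> is the difference of the unit vectors at \<open>i\<close> and
  \<open>f i\<close>; the second one vanishes when \<open>f i = n\<close>, since column
  \<open>n\<close> is deleted.\<close>

definition functional_mat :: "nat \<Rightarrow> (nat \<Rightarrow> nat) \<Rightarrow> int mat" where
  "functional_mat n f = mat n n (\<lambda>(i, j). of_bool (i = j) - of_bool (f i = j))"

text \<open>In the Leibniz expansion a permutation with nonzero product agrees with \<open>f\<close>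
  wherever it moves an index. The \<open>f\<close>-orbit of a moved index then consists of moved
  indices below \<open>n\<close> and never reaches \<open>n\<close>, so only the identity
  contributes.\<close>

lemma det_functional_mat_reaching:
  assumes reach: "\<And>i. i < n \<Longrightarrow> \<exists>t. (f ^^ t) i = n"
  shows "det (functional_mat n f) = 1"
proof -
  let ?a = "\<lambda>i j. of_bool (i = j) - of_bool (f i = j) :: int"
  have nofix: "f i \<noteq> i" if i: "i < n" for i
  proof
    assume "f i = i"
    then have "(f ^^ t) i = i" for t by (induction t) auto
    then show False using reach[OF i] i by auto
  qed
  have vanish: "(\<Prod>i = 0..<n. ?a i (p i)) = 0" if p: "p permutes {0..<n}" and "p \<noteq> id" for p
  proof (rule ccontr)
    assume nz: "(\<Prod>i = 0..<n. ?a i (p i)) \<noteq> 0"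
    have fp: "f i = p i" if "i < n" "p i \<noteq> i" for i
    proof -
      have "?a i (p i) \<noteq> 0" using nz that(1) unfolding prod_zero_iff[OF finite_atLeastLessThan] by simp
      then show ?thesis using that by (cases "f i = p i") auto
    qed
    obtain i where "p i \<noteq> i" using \<open>p \<noteq> id\<close> by (auto simp: fun_eq_iff)
    then have i: "i < n" using p by (metis atLeastLessThan_iff permutes_not_in zero_le)
    have step: "f j < n \<and> p (f j) \<noteq> f j" if j: "j < n" "p j \<noteq> j" for j
    proof -
      have "p j < n" using permutes_in_image[OF p, of j] j by simp
      moreover have "p (p j) \<noteq> p j" using permutes_inj[OF p] j by (simp add: inj_eq)
      ultimately show ?thesis using fp[OF j] by simp
    qed
    have "(f ^^ t) i < n \<and> p ((f ^^ t) i) \<noteq> (f ^^ t) i" for t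
    proof (induction t)
      case (Suc t)
      then show ?case using step[of "(f ^^ t) i"] by simp
    qed (use i \<open>p i \<noteq> i\<close> in simp)
    then have "(f ^^ t) i \<noteq> n" for t by (metis less_irrefl)
    then show False using reach[OF i] by auto
  qed
  have "det (functional_mat n f) =
      (\<Sum>p | p permutes {0..<n}. signof p * (\<Prod>i = 0..<n. functional_mat n f $$ (i, p i)))"
    by (rule det_def') (simp add: functional_mat_def)
  also have "\<dots> = (\<Sum>p | p permutes {0..<n}. signof p * (\<Prod>i = 0..<n. ?a i (p i)))"
    by (intro sum.cong refl arg_cong2[where f = "(*)"] prod.cong)
      (auto simp: functional_mat_def permutes_less_nat)
  also have "\<dots> = (\<Sum>p\<in>{id}. signof p * (\<Prod>i = 0..<n. ?a i (p i)))"
    by (rule sum.mono_neutral_right)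
      (auto simp: finite_permutations permutes_id vanish)
  also have "\<dots> = 1" using nofix by (simp add: sign_id)
  finally show ?thesis .
qed

text \<open>The indicator vector of the set of indices that never reach \<open>n\<close> lies in the kernel.\<close>

lemma det_functional_mat_not_reaching:
  assumes range: "\<And>i. i < n \<Longrightarrow> f i \<le> n" and "i0 < n" and i0: "\<And>t. (f ^^ t) i0 \<noteq> n"
  shows "det (functional_mat n f) = 0"
proof -
  define C where "C = {i. i < n \<and> (\<forall>t. (f ^^ t) i \<noteq> n)}"
  have C_step: "i \<in> C \<longleftrightarrow> f i \<in> C" if i: "i < n" for i
  proof
    assume "i \<in> C"
    then have *: "(f ^^ Suc t) i \<noteq> n" for t unfolding C_def by blast
    have "f i < n" using *[of 0] range[OF i] by simp
    then show "f i \<in> C" using * by (simp add: C_def funpow_swap1)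
  next
    assume "f i \<in> C"
    then have "(f ^^ Suc t) i \<noteq> n" for t by (simp add: C_def funpow_swap1)
    then have "(f ^^ t) i \<noteq> n" for t using i by (cases t) auto
    then show "i \<in> C" using i by (simp add: C_def)
  qed
  define v :: "int vec" where "v = vec n (\<lambda>i. of_bool (i \<in> C))"
  have C_less: "i \<in> C \<Longrightarrow> i < n" for i by (simp add: C_def)
  have "functional_mat n f *\<^sub>v v = 0\<^sub>v n"
  proof (rule eq_vecI)
    fix i assume i: "i < dim_vec (0\<^sub>v n)"
    have "(functional_mat n f *\<^sub>v v) $ i =
        (\<Sum>j = 0..<n. (of_bool (i = j) - of_bool (f i = j)) * of_bool (j \<in> C))"
      using i by (simp add: functional_mat_def v_def scalar_prod_def)
    also have "\<dots> = (\<Sum>j = 0..<n. if i = j then of_bool (j \<in> C) else 0)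
        - (\<Sum>j = 0..<n. if f i = j then of_bool (j \<in> C) else 0)"
      by (subst sum_subtractf[symmetric]) (intro sum.cong refl, auto)
    also have "\<dots> = 0" using i C_step[of i] C_less[of "f i"] by (auto simp: sum.delta')
    finally show "(functional_mat n f *\<^sub>v v) $ i = 0\<^sub>v n $ i" using i by simp
  qed (simp add: functional_mat_def)
  moreover have "v \<noteq> 0\<^sub>v n"
  proof
    assume "v = 0\<^sub>v n"
    then have "v $ i0 = 0" using \<open>i0 < n\<close> by simp
    then show False using assms by (simp add: v_def C_def)
  qed
  moreover have "v \<in> carrier_vec n" by (simp add: v_def)
  moreover have "functional_mat n f \<in> carrier_mat n n" by (simp add: functional_mat_def)
  ultimately show ?thesis by (subst det_0_iff_vec_prod_zero) blast+
qed

text \<open>Each row of the reduced Laplacian is a sum over the neighbours \<open>u\<close> of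
  \<open>i\<close> of rows of the \<open>functional_mat\<close> kind. By multilinearity the
  determinant is a sum over all choices \<open>f\<close> of neighbours, and a choice contributes 1
  if it is a parent map and 0 otherwise.\<close>

theorem matrix_tree:
  assumes E: "E \<subseteq> nsets {..n} 2"
  shows "int (tau {..n} E) = det (reduced_laplacian n E)"
proof -
  define S where "S i = {u. u \<le> n \<and> {i, u} \<in> E}" for i
  let ?a = "\<lambda>i u j. of_bool (i = j) - of_bool (u = j) :: int"
  have fin: "finite (S i)" for i by (simp add: S_def)
  have loop: "{i, i} \<notin> E" for i using E by (auto simp: nsets_def)
  have entry: "reduced_laplacian n E $$ (i, j) = (\<Sum>u\<in>S i. ?a i u j)" if "i < n" "j < n" for i j
  proof -
    have "(\<Sum>u\<in>S i. of_bool (u = j)) = (of_bool (j \<in> S i) :: int)"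
      using fin[of i] by (simp add: of_bool_def sum.delta)
    then show ?thesis using that loop by (auto simp: reduced_laplacian_def sum_subtractf S_def)
  qed
  let ?P = "{p. p permutes {0..<n}}" and ?F = "PiE {0..<n} S"
  have maps: "{f \<in> ?F. \<forall>i<n. \<exists>t. (f ^^ t) i = n} = parent_maps {..n} n E"
  proof -
    have minus: "{..n} - {n} = {0..<n}" and insert: "{..n} = insert n {0..<n}" by auto
    have "\<exists>t. (f ^^ t) n = n" for f :: "nat \<Rightarrow> nat" by (rule exI[of _ 0]) simp
    then have reach: "(\<forall>v\<in>{..n}. \<exists>t. (f ^^ t) v = n) \<longleftrightarrow> (\<forall>i<n. \<exists>t. (f ^^ t) i = n)"
      for f :: "nat \<Rightarrow> nat" unfolding insert by auto
    have "f \<in> ?F \<longleftrightarrow> f \<in> {0..<n} \<rightarrow>\<^sub>E {..n} \<and> (\<forall>v\<in>{0..<n}. {v, f v} \<in> E)" for f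
      by (auto simp: PiE_iff S_def)
    then show ?thesis unfolding parent_maps_def minus reach by simp
  qed
  have "det (reduced_laplacian n E) =
      (\<Sum>p\<in>?P. signof p * (\<Prod>i = 0..<n. reduced_laplacian n E $$ (i, p i)))"
    by (rule det_def') (simp add: reduced_laplacian_def)
  also have "\<dots> = (\<Sum>p\<in>?P. signof p * (\<Prod>i = 0..<n. \<Sum>u\<in>S i. ?a i u (p i)))"
    by (intro sum.cong refl arg_cong2[where f = "(*)"] prod.cong)
      (auto simp: entry permutes_less_nat)
  also have "\<dots> = (\<Sum>p\<in>?P. \<Sum>f\<in>?F. signof p * (\<Prod>i = 0..<n. ?a i (f i) (p i)))"
    by (subst prod_sum_PiE) (simp_all add: fin sum_distrib_left)
  also have "\<dots> = (\<Sum>f\<in>?F. \<Sum>p\<in>?P. signof p * (\<Prod>i = 0..<n. ?a i (f i) (p i)))"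
    by (rule sum.swap)
  also have "\<dots> = (\<Sum>f\<in>?F. det (functional_mat n f))"
  proof (rule sum.cong[OF refl])
    fix f
    have "det (functional_mat n f) =
        (\<Sum>p\<in>?P. signof p * (\<Prod>i = 0..<n. functional_mat n f $$ (i, p i)))"
      by (rule det_def') (simp add: functional_mat_def)
    also have "\<dots> = (\<Sum>p\<in>?P. signof p * (\<Prod>i = 0..<n. ?a i (f i) (p i)))"
      by (intro sum.cong refl arg_cong2[where f = "(*)"] prod.cong)
        (auto simp: functional_mat_def permutes_less_nat)
    finally show "(\<Sum>p\<in>?P. signof p * (\<Prod>i = 0..<n. ?a i (f i) (p i))) = det (functional_mat n f)"
      by (rule sym)
  qed
  also have "\<dots> = (\<Sum>f\<in>?F. of_bool (\<forall>i<n. \<exists>t. (f ^^ t) i = n))"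
  proof (rule sum.cong[OF refl])
    fix f assume f: "f \<in> ?F"
    then have range: "f i \<le> n" if "i < n" for i using that by (auto simp: PiE_iff S_def)
    show "det (functional_mat n f) = of_bool (\<forall>i<n. \<exists>t. (f ^^ t) i = n)"
    proof (cases "\<forall>i<n. \<exists>t. (f ^^ t) i = n")
      case True
      then show ?thesis using det_functional_mat_reaching[of n f] by simp
    next
      case False
      then obtain i0 where "i0 < n" "\<And>t. (f ^^ t) i0 \<noteq> n" by blast
      then show ?thesis
        using det_functional_mat_not_reaching[OF range] False by simp
    qed
  qed
  also have "\<dots> = int (card {f \<in> ?F. \<forall>i<n. \<exists>t. (f ^^ t) i = n})"
  proof -
    have "finite ?F" using fin by (intro finite_PiE) auto
    then show ?thesis by (simp add: Int_def)
  qed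
  also have "\<dots> = int (tau {..n} E)"
    unfolding maps by (subst tau_eq_card_parent_maps[where r = n]) (use E in \<open>auto simp: simple_graph_def\<close>)
  finally show ?thesis by (rule sym)
qed

subsection \<open>Doubling and continuants\<close>

text \<open>The vectors that are supported on the two copies and antisymmetric under exchanging them
  form an invariant sublattice, and the outer \<open>p\<close> indices do not contribute to it.\<close>

lemma det_doubled_block_dvd:
  fixes l :: "nat \<Rightarrow> nat \<Rightarrow> int"
  assumes cross: "\<And>i j. i < k \<Longrightarrow> j < k \<Longrightarrow> l (p + i) (p + k + j) = 0 \<and> l (p + k + i) (p + j) = 0"
    and copy: "\<And>i j. i < k \<Longrightarrow> j < k \<Longrightarrow> l (p + k + i) (p + k + j) = l (p + i) (p + j)"
    and outer: "\<And>i j. i < k \<Longrightarrow> j < p \<Longrightarrow> l (p + k + i) j = l (p + i) j"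
  shows "det (mat k k (\<lambda>(i, j). l (p + i) (p + j))) dvd
    det (mat (p + 2 * k) (p + 2 * k) (\<lambda>(i, j). l i j))"
proof -
  let ?a = "p + k"
  define A where "A = mat ?a ?a (\<lambda>(i, j). l i j)"
  define B where "B = mat ?a k (\<lambda>(i, j). l i (p + k + j))"
  define C where "C = mat k ?a (\<lambda>(i, j). l (p + k + i) j)"
  define M where "M = mat k k (\<lambda>(i, j). l (p + i) (p + j))"
  \<comment> \<open>Left multiplication by \<open>Q\<close> selects the rows of the first
    copy.\<close>
  define Q where "Q = mat k ?a (\<lambda>(i, j). of_bool (j = p + i) :: int)"
  note defs = A_def B_def C_def M_def Q_def
  have carr [simp]: "A \<in> carrier_mat ?a ?a" "B \<in> carrier_mat ?a k" "C \<in> carrier_mat k ?a"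
    "M \<in> carrier_mat k k" "Q \<in> carrier_mat k ?a" by (simp_all add: defs)
  have L: "mat (p + 2 * k) (p + 2 * k) (\<lambda>(i, j). l i j) = four_block_mat A B C M" (is "?L = _")
  proof (rule eq_matI)
    fix i j assume "i < dim_row (four_block_mat A B C M)" "j < dim_col (four_block_mat A B C M)"
    then have ij: "i < ?a + k" "j < ?a + k" by (simp_all add: defs)
    have M: "M $$ (i - ?a, j - ?a) = l i j" if "\<not> i < ?a" "\<not> j < ?a"
    proof -
      have "i - ?a < k" "j - ?a < k" using ij that by auto
      then show ?thesis using copy[of "i - ?a" "j - ?a"] that by (simp add: M_def)
    qed
    show "?L $$ (i, j) = four_block_mat A B C M $$ (i, j)"
      using ij M by (auto simp: A_def B_def C_def M_def)
  qed (simp_all add: defs)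
  have Q_mult: "(Q * X) $$ (i, j) = X $$ (p + i, j)"
    if "X \<in> carrier_mat ?a m" "i < k" "j < m" for X m i j
  proof -
    have "(Q * X) $$ (i, j) = (\<Sum>t = 0..<?a. of_bool (t = p + i) * X $$ (t, j))"
      using that by (simp add: Q_def scalar_prod_def)
    also have "\<dots> = (\<Sum>t = 0..<?a. if p + i = t then X $$ (t, j) else 0)"
      by (intro sum.cong) auto
    also have "\<dots> = X $$ (p + i, j)" using that by (simp add: sum.delta)
    finally show ?thesis .
  qed
  have QB: "Q * B = 0\<^sub>m k k"
  proof (rule eq_matI)
    fix i j assume "i < dim_row (0\<^sub>m k k)" "j < dim_col (0\<^sub>m k k)"
    then show "(Q * B) $$ (i, j) = 0\<^sub>m k k $$ (i, j)"
      using Q_mult[of B k i j] cross[of i j] by (simp add: B_def)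
  qed (simp_all add: defs)
  \<comment> \<open>In the rows of the first copy, \<open>C\<close> supplies the outer columns,
    which are the same for both copies, and \<open>M * Q\<close> the columns of the first copy,
    where \<open>C\<close> is zero.\<close>
  have QA: "Q * A = C + M * Q"
  proof (rule eq_matI)
    fix i j assume "i < dim_row (C + M * Q)" "j < dim_col (C + M * Q)"
    then have ij: "i < k" "j < ?a" by (simp_all add: defs)
    have "(M * Q) $$ (i, j) = (\<Sum>t = 0..<k. l (p + i) (p + t) * of_bool (j = p + t))"
      using ij by (simp add: M_def Q_def scalar_prod_def)
    also have "\<dots> = (if j < p then 0 else l (p + i) j)"
    proof (cases "j < p")
      case False
      then have "(\<Sum>t = 0..<k. l (p + i) (p + t) * of_bool (j = p + t)) =
          (\<Sum>t = 0..<k. if j - p = t then l (p + i) (p + t) else 0)"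
        by (intro sum.cong) auto
      also have "\<dots> = l (p + i) j" using False ij by (auto simp: sum.delta)
      finally show ?thesis using False by simp
    qed (auto intro: sum.neutral)
    finally have MQ: "(M * Q) $$ (i, j) = (if j < p then 0 else l (p + i) j)" .
    have "C $$ (i, j) = (if j < p then l (p + i) j else 0)"
      using ij outer[of i j] cross[of i "j - p"] by (auto simp: C_def)
    then have "(C + M * Q) $$ (i, j) = l (p + i) j"
      using ij MQ by (simp add: C_def M_def Q_def)
    also have "\<dots> = (Q * A) $$ (i, j)" using Q_mult[of A ?a i j] ij by (simp add: A_def)
    finally show "(Q * A) $$ (i, j) = (C + M * Q) $$ (i, j)" by (rule sym)
  qed (simp_all add: defs)
  \<comment> \<open>Conjugation by \<open>?P\<close> adds the columns of the second copy to their
    twins and subtracts the rows of the first copy from theirs. The result \<open>?R\<close> is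
    block triangular with diagonal block \<open>M\<close>. Comparing products on both sides avoids
    the inverse of \<open>?P\<close>.\<close>
  let ?P = "four_block_mat (1\<^sub>m ?a) (0\<^sub>m ?a k) Q (1\<^sub>m k)"
  let ?R = "four_block_mat (A + B * Q) B (0\<^sub>m k ?a) M"
  have BQ [simp]: "B * Q \<in> carrier_mat ?a ?a" by (rule mult_carrier_mat[of _ _ k]) auto
  have "Q * (A + B * Q) = Q * A + Q * (B * Q)"
    by (rule mult_add_distrib_mat[of _ k ?a _ ?a]) auto
  also have "Q * (B * Q) = (Q * B) * Q"
    by (rule assoc_mult_mat[symmetric, of _ k ?a _ k _ ?a]) auto
  also have "\<dots> = 0\<^sub>m k ?a" unfolding QB by (rule left_mult_zero_mat) simp
  also have "Q * A + 0\<^sub>m k ?a = Q * A"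
    by (rule right_add_zero_mat[of _ k ?a]) (rule mult_carrier_mat[of _ _ ?a], auto)
  finally have QAB: "Q * (A + B * Q) = C + M * Q" by (simp only: QA)
  have "four_block_mat A B C M * ?P = four_block_mat (A + B * Q) B (C + M * Q) M"
    by (subst mult_four_block_mat[of _ ?a ?a _ k _ k _ _ ?a _ k]) (auto simp: defs)
  moreover have "?P * ?R = four_block_mat (A + B * Q) B (C + M * Q) M"
    by (subst mult_four_block_mat[of _ ?a ?a _ k _ k _ _ ?a _ k])
      (auto simp: QAB QB, auto simp: defs)
  ultimately have eq: "four_block_mat A B C M * ?P = ?P * ?R" by simp
  have P: "?P \<in> carrier_mat (?a + k) (?a + k)" by (intro four_block_carrier_mat) auto
  have R: "?R \<in> carrier_mat (?a + k) (?a + k)" by (intro four_block_carrier_mat) auto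
  have F: "four_block_mat A B C M \<in> carrier_mat (?a + k) (?a + k)"
    by (intro four_block_carrier_mat) auto
  have detP: "det ?P = 1"
    by (subst det_four_block_mat_upper_right_zero[of _ ?a _ k]) auto
  have detR: "det ?R = det (A + B * Q) * det M"
    by (rule det_four_block_mat_lower_left_zero[of _ ?a _ k]) auto
  have "det (four_block_mat A B C M) * det ?P = det ?P * det ?R"
    unfolding det_mult[OF F P, symmetric] det_mult[OF P R, symmetric] eq ..
  then show ?thesis using detP detR unfolding L M_def[symmetric] by simp
qed

section \<open>Tridiagonal determinants and continuants\<close>

definition chain_mat :: "int list \<Rightarrow> int mat" where
  "chain_mat ds = mat (length ds) (length ds) (\<lambda>(i, j).
     if i = j then ds ! i else if i = Suc j \<or> j = Suc i then - 1 else 0)"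

text \<open>The continuant of negative (Hirzebruch-Jung) continued fractions, hence the minus
  sign.\<close>

fun continuant :: "int list \<Rightarrow> int" where
  "continuant [] = 1"
| "continuant [d] = d"
| "continuant (d # e # ds) = d * continuant (e # ds) - continuant ds"

text \<open>Expansion along the first row, and of the second minor along its first column, gives the
  three-term recursion.\<close>

lemma det_chain_mat: "det (chain_mat ds) = continuant ds"
proof (induction ds rule: continuant.induct)
  case 1
  show ?case by (simp add: chain_mat_def)
next
  case (2 d)
  show ?case by (subst det_single) (simp_all add: chain_mat_def)
next
  case (3 d e ds)
  let ?k = "length ds" and ?M = "chain_mat (d # e # ds)"
  have M: "?M \<in> carrier_mat (Suc (Suc ?k)) (Suc (Suc ?k))" by (simp add: chain_mat_def)
  let ?X = "mat_delete ?M 0 (Suc 0)"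
  have X: "?X \<in> carrier_mat (Suc ?k) (Suc ?k)" using mat_delete_carrier[OF M] by simp
  have del00: "mat_delete ?M 0 0 = chain_mat (e # ds)"
    by (rule eq_matI) (auto simp: mat_delete_def chain_mat_def)
  have delX: "mat_delete ?X 0 0 = chain_mat ds"
    by (rule eq_matI) (auto simp: mat_delete_def chain_mat_def)
  have X0: "?X $$ (i, 0) = (if i = 0 then - 1 else 0)" if "i < Suc ?k" for i
    using that by (simp add: mat_delete_def chain_mat_def)
  have "det ?X = (\<Sum>i<Suc ?k. ?X $$ (i, 0) * cofactor ?X i 0)"
    by (rule laplace_expansion_column[OF X]) simp
  also have "\<dots> = - cofactor ?X 0 0"
    by (subst sum.lessThan_Suc_shift) (simp add: X0)
  also have "\<dots> = - continuant ds"
    using 3 by (simp add: cofactor_def delX)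
  finally have detX: "det ?X = - continuant ds" .
  have M0: "?M $$ (0, 0) = d" "?M $$ (0, Suc 0) = - 1" by (simp_all add: chain_mat_def)
  have M0': "?M $$ (0, Suc (Suc j)) = 0" if "j < ?k" for j
    using that by (simp add: chain_mat_def)
  have "det ?M = (\<Sum>j<Suc (Suc ?k). ?M $$ (0, j) * cofactor ?M 0 j)"
    by (rule laplace_expansion_row[OF M]) simp
  also have "\<dots> = d * cofactor ?M 0 0 - cofactor ?M 0 (Suc 0)"
    by (simp only: sum.lessThan_Suc_shift) (simp add: M0 M0')
  also have "cofactor ?M 0 0 = continuant (e # ds)"
    using 3 by (simp add: cofactor_def del00)
  also have "cofactor ?M 0 (Suc 0) = continuant ds"
    using detX by (simp add: cofactor_def)
  finally show ?case by simp
qed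

text \<open>With entries at least 2, prepending an entry at least doubles the continuant and
  subtracts a smaller one, so continuants grow strictly.\<close>

lemma continuant_bounds:
  assumes "\<forall>d\<in>set ds. 2 \<le> d"
  shows "0 < continuant ds \<and> (ds \<noteq> [] \<longrightarrow> continuant (tl ds) < continuant ds)"
  using assms
proof (induction ds rule: continuant.induct)
  case (3 d e ds)
  then have IH: "0 < continuant (e # ds)" "continuant ds < continuant (e # ds)" by auto
  have "2 * continuant (e # ds) \<le> d * continuant (e # ds)"
    using 3 IH by (intro mult_right_mono) auto
  then have "continuant (e # ds) < d * continuant (e # ds) - continuant ds"
    using IH by linarith
  then show ?case using IH by auto
qed auto

text \<open>\<open>continuant xs / continuant (tl xs)\<close> is the value of a negative continued fraction, whose
  partial quotients are recovered by repeatedly taking ceilings.\<close>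

lemma continuant_inj:
  assumes "length xs = length ys" "\<forall>d\<in>set xs. 2 \<le> d" "\<forall>d\<in>set ys. 2 \<le> d"
    and "continuant xs = continuant ys" "continuant (tl xs) = continuant (tl ys)"
  shows "xs = ys"
  using assms
proof (induction xs ys rule: list_induct2)
  case (Cons x xs y ys)
  show ?case
  proof (cases xs)
    case Nil
    then show ?thesis using Cons by simp
  next
    case (Cons a xs')
    then obtain b ys' where ys: "ys = b # ys'" using \<open>length xs = length ys\<close> by (cases ys) auto
    let ?q = "continuant xs"
    have q: "?q = continuant ys" using Cons.prems by simp
    have "x * ?q - continuant xs' = y * ?q - continuant ys'"
      using Cons.prems(3) q ys \<open>xs = a # xs'\<close> by simp
    \<comment> \<open>The right-hand side is a difference of two numbers strictly between 0 and
      \<open>?q\<close>, which forces \<open>x = y\<close>; then it is zero, which is the second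
      premise for the tails.\<close>
    then have diff: "(x - y) * ?q = continuant xs' - continuant ys'" by (simp add: algebra_simps)
    have bx: "0 < continuant xs'" "continuant xs' < ?q"
      using continuant_bounds[of xs'] continuant_bounds[of xs] Cons.prems(1) \<open>xs = a # xs'\<close> by auto
    have byy: "0 < continuant ys'" "continuant ys' < ?q"
      using continuant_bounds[of ys'] continuant_bounds[of ys] Cons.prems(2) ys q by auto
    have "\<bar>x - y\<bar> * ?q = \<bar>continuant xs' - continuant ys'\<bar>"
      using diff bx by (metis abs_mult abs_of_pos order.strict_trans)
    also have "\<dots> < 1 * ?q" using bx byy by linarith
    finally have "\<bar>x - y\<bar> * ?q < 1 * ?q" .
    then have "x = y" using bx by (simp add: mult_less_cancel_right)
    moreover from this have "continuant (tl xs) = continuant (tl ys)"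
      using diff \<open>xs = a # xs'\<close> ys by simp
    then have "xs = ys" using Cons.IH Cons.prems q by simp
    ultimately show ?thesis by simp
  qed
qed simp

subsection \<open>The doubled path graph\<close>

text \<open>On the vertices \<open>{..p + 2 * k}\<close>, vertex \<open>p + 2 * k\<close> is adjacent to all others, the
  vertices \<open>q + i\<close> with \<open>i < k\<close> form a path for each \<open>q \<in> {p, p + k}\<close>, and \<open>q + i\<close> has
  \<open>s i \<le> p\<close> further neighbours, the vertices in \<open>{..<s i}\<close>. The relation below is only meaningful
  for \<open>x < y\<close>.\<close>

definition chain_adj :: "nat \<Rightarrow> nat \<Rightarrow> (nat \<Rightarrow> nat) \<Rightarrow> nat \<Rightarrow> nat \<Rightarrow> bool" where
  "chain_adj p k s x y \<longleftrightarrow> y = p + 2 * k \<or>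
     (\<exists>q\<in>{p, p + k}. \<exists>i<k. y = q + i \<and> (x < s i \<or> 0 < i \<and> y = Suc x))"

definition chain_edges :: "nat \<Rightarrow> nat \<Rightarrow> (nat \<Rightarrow> nat) \<Rightarrow> nat set set" where
  "chain_edges p k s = {{x, y} | x y. x < y \<and> y \<le> p + 2 * k \<and> chain_adj p k s x y}"

lemma chain_edges_subset: "chain_edges p k s \<subseteq> nsets {..p + 2 * k} 2"
  by (auto simp: chain_edges_def)

lemma in_chain_edges_iff:
  assumes "x < y"
  shows "{x, y} \<in> chain_edges p k s \<longleftrightarrow> y \<le> p + 2 * k \<and> chain_adj p k s x y"
  using assms by (auto simp: chain_edges_def doubleton_eq_iff)

text \<open>The two copies occupy disjoint intervals, so the witnesses in \<open>chain_adj\<close>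
  are unique.\<close>

lemma chain_adj_iff:
  assumes "q \<in> {p, p + k}" "i < k"
  shows "chain_adj p k s x (q + i) \<longleftrightarrow> x < s i \<or> 0 < i \<and> q + i = Suc x"
proof -
  have uniq: "q' = q \<and> i' = i" if "q' \<in> {p, p + k}" "i' < k" "q + i = q' + i'" for q' i'
    using assms that by auto
  show ?thesis (is "?l \<longleftrightarrow> ?r")
  proof
    assume ?l
    moreover have "q + i \<noteq> p + 2 * k" using assms by auto
    ultimately obtain q' i' where "q' \<in> {p, p + k}" "i' < k" "q + i = q' + i'"
      "x < s i' \<or> 0 < i' \<and> q + i = Suc x" unfolding chain_adj_def by blast
    then show ?r using uniq by blast
  next
    assume ?r
    then show ?l unfolding chain_adj_def using assms by blast
  qed
qed

text \<open>Further neighbours lie below \<open>p\<close>, so only the root and the path successor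
  remain. The condition \<open>0 < i\<close> in \<open>chain_adj\<close> keeps the end of the first
  copy from being joined to the start of the second.\<close>

lemma chain_adj_above:
  assumes "q \<in> {p, p + k}" "i < k" "\<And>i. i < k \<Longrightarrow> s i \<le> p" "q + i < u"
  shows "chain_adj p k s (q + i) u \<longleftrightarrow> u = p + 2 * k \<or> Suc i < k \<and> u = Suc (q + i)"
proof
  assume l: "chain_adj p k s (q + i) u"
  show "u = p + 2 * k \<or> Suc i < k \<and> u = Suc (q + i)"
  proof (cases "u = p + 2 * k")
    case False
    then obtain q' i' where *: "q' \<in> {p, p + k}" "i' < k" "u = q' + i'"
      "q + i < s i' \<or> 0 < i' \<and> u = Suc (q + i)" using l unfolding chain_adj_def by blast
    have "p \<le> q" using assms by auto
    then have "\<not> q + i < s i'" using assms(3)[OF *(2)] by linarith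
    then have "0 < i'" "u = Suc (q + i)" using * by auto
    then show ?thesis using * assms(1,2) by auto
  qed simp
next
  assume "u = p + 2 * k \<or> Suc i < k \<and> u = Suc (q + i)"
  then show "chain_adj p k s (q + i) u"
    using chain_adj_iff[OF assms(1), of "Suc i" s "q + i"] by (auto simp: chain_adj_def)
qed

text \<open>The summands count further neighbours, path predecessor, path successor and
  root.\<close>

lemma card_chain_nbrs:
  assumes q: "q \<in> {p, p + k}" and i: "i < k" and s: "\<And>i. i < k \<Longrightarrow> s i \<le> p"
  shows "card {u. u \<le> p + 2 * k \<and> {q + i, u} \<in> chain_edges p k s} =
    s i + of_bool (0 < i) + of_bool (Suc i < k) + 1"
proof -
  let ?n = "p + 2 * k"
  have qn: "p \<le> q" "q + k \<le> ?n" using q by auto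
  let ?L = "{..<s i} \<union> (if 0 < i then {q + i - 1} else {})"
  let ?U = "insert ?n (if Suc i < k then {Suc (q + i)} else {})"
  have "{u. u \<le> ?n \<and> {q + i, u} \<in> chain_edges p k s} = ?L \<union> ?U"
  proof (rule Set.set_eqI)
    fix u
    consider "u < q + i" | "u = q + i" | "q + i < u" by linarith
    then show "u \<in> {u. u \<le> ?n \<and> {q + i, u} \<in> chain_edges p k s} \<longleftrightarrow> u \<in> ?L \<union> ?U"
    proof cases
      case 1
      have "{q + i, u} = {u, q + i}" by auto
      then have "{q + i, u} \<in> chain_edges p k s \<longleftrightarrow> u < s i \<or> 0 < i \<and> q + i = Suc u"
        using in_chain_edges_iff[OF 1] chain_adj_iff[OF q i] qn i by simp
      then show ?thesis using 1 qn i by auto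
    next
      case 2
      have "{q + i, u} \<notin> chain_edges p k s"
        using subsetD[OF chain_edges_subset, of "{q + i}" p k s] 2 by (auto simp: nsets_def)
      moreover have "u \<notin> ?L \<union> ?U" using 2 qn i s[OF i] by auto
      ultimately show ?thesis by simp
    next
      case 3
      show ?thesis
        using in_chain_edges_iff[OF 3] chain_adj_above[OF q i s 3] 3 qn i s[OF i] by auto
    qed
  qed
  moreover have "card ?L = s i + of_bool (0 < i)"
    using s[OF i] qn by (auto simp: card_insert_if)
  moreover have "card ?U = of_bool (Suc i < k) + 1"
    using qn i by (auto simp: card_insert_if)
  moreover have "card (?L \<union> ?U) = card ?L + card ?U"
    using s[OF i] qn i by (intro card_Un_disjoint) auto
  ultimately show ?thesis by (simp only:)
qed

text \<open>The star at the root is a spanning tree. Positivity matters because 0 has infinitely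
  many divisors.\<close>

lemma tau_chain_pos: "0 < tau {..p + 2 * k} (chain_edges p k s)"
proof -
  let ?n = "p + 2 * k" let ?E = "chain_edges p k s"
  have sg: "simple_graph {..?n} ?E" using chain_edges_subset by (auto simp: simple_graph_def)
  let ?f = "restrict (\<lambda>_. ?n) ({..?n} - {?n})"
  have "?f \<in> parent_maps {..?n} ?n ?E"
  proof -
    have "{v, ?n} \<in> ?E" if "v < ?n" for v
      using in_chain_edges_iff[OF that] by (simp add: chain_adj_def)
    moreover have "\<exists>t. (?f ^^ t) v = ?n" if "v \<le> ?n" for v
    proof (cases "v = ?n")
      case True
      then show ?thesis by (intro exI[of _ 0]) simp
    next
      case False
      then show ?thesis using that by (intro exI[of _ 1]) simp
    qed
    ultimately show ?thesis by (auto simp: parent_maps_def)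
  qed
  moreover have "finite (parent_maps {..?n} ?n ?E)"
    by (rule finite_subset[of _ "({..?n} - {?n}) \<rightarrow>\<^sub>E {..?n}"])
      (auto simp: parent_maps_def intro: finite_PiE)
  ultimately show ?thesis
    using tau_eq_card_parent_maps[OF sg, of ?n] by (auto simp: card_gt_0_iff)
qed

text \<open>The entries of \<open>ds\<close> become the degrees on both paths: at least 3 leaves
  room for the root and two path neighbours, and the upper bound gives \<open>s i \<le> p\<close>.
  The block of one copy is then \<open>chain_mat ds\<close>.\<close>

lemma continuant_dvd_tau:
  assumes "\<forall>d\<in>set ds. 3 \<le> d \<and> d + 2 * int (length ds) \<le> int n"
    and "2 * length ds < n"
  shows "\<exists>t\<in>tau_values n. continuant ds dvd int t \<and> 0 < t \<and> t \<le> n ^ n"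
proof -
  define k where "k = length ds"
  \<comment> \<open>One vertex is set aside for the root.\<close>
  define p where "p = n - 1 - 2 * k"
  define s where "s i = nat (ds ! i) - 1 - of_bool (0 < i) - of_bool (Suc i < k)" for i
  have n: "n = Suc (p + 2 * k)" using assms(2) by (simp add: p_def k_def)
  have d: "3 \<le> ds ! i" "ds ! i \<le> int (Suc p)" if "i < k" for i
    using assms(1) that n nth_mem[of i ds] by (auto simp: k_def)
  have s_le: "s i \<le> p" if "i < k" for i using d[OF that] by (auto simp: s_def)
  have s: "int (s i) + of_bool (0 < i) + of_bool (Suc i < k) + 1 = ds ! i" if "i < k" for i
    using d[OF that] by (auto simp: s_def)
  let ?n = "p + 2 * k"
  let ?E = "chain_edges p k s"
  define l where "l i j = (if i = j then int (card {u. u \<le> ?n \<and> {i, u} \<in> ?E})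
    else if {i, j} \<in> ?E then - 1 else 0)" for i j
  have diag: "l (q + i) (q + i) = ds ! i" if "q \<in> {p, p + k}" "i < k" for q i
    using card_chain_nbrs[where s = s, OF that s_le] s[OF that(2)] by (simp add: l_def)
  have sym: "l i j = l j i" for i j by (simp add: l_def insert_commute)
  have path: "l (q + i) (q + j) = (if i = j then ds ! i else if i = Suc j \<or> j = Suc i then - 1 else 0)"
    if q: "q \<in> {p, p + k}" and ij: "i < k" "j < k" for q i j
  proof -
    have lt: "l (q + i) (q + j) = (if j = Suc i then - 1 else 0)" if "i < j" "j < k" for i j
    proof -
      have "q + j \<le> ?n" "q + j \<noteq> ?n" using q that by auto
      then have "{q + i, q + j} \<in> ?E \<longleftrightarrow> j = Suc i"
        using in_chain_edges_iff[of "q + i" "q + j" p k s] that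
          chain_adj_above[where s = s, OF q _ s_le, of i "q + j"] by auto
      then show ?thesis using that by (simp add: l_def)
    qed
    consider "i < j" | "i = j" | "j < i" by linarith
    then show ?thesis
      using lt[of i j] lt[of j i] diag[OF q ij(1)] ij sym[of "q + i" "q + j"] by cases auto
  qed
  have cross: "l (p + i) (p + k + j) = 0" if "i < k" "j < k" for i j
  proof -
    have "{p + i, p + k + j} \<notin> ?E"
      using in_chain_edges_iff[of "p + i" "p + k + j" p k s] that s_le[OF that(2)]
        chain_adj_iff[of "p + k" p k j s "p + i"] by auto
    then show ?thesis using that by (simp add: l_def)
  qed
  have outer: "l (q + i) j = (if j < s i then - 1 else 0)"
    if "q \<in> {p, p + k}" "i < k" "j < p" for q i j
  proof -
    have "p \<le> q" "q + i \<le> ?n" using that by auto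
    moreover have "{q + i, j} = {j, q + i}" by auto
    ultimately have "{q + i, j} \<in> ?E \<longleftrightarrow> j < s i"
      using in_chain_edges_iff[of j "q + i" p k s] chain_adj_iff[OF that(1,2), of s j] that by auto
    then show ?thesis using that \<open>p \<le> q\<close> by (simp add: l_def)
  qed
  have "det (mat k k (\<lambda>(i, j). l (p + i) (p + j))) dvd
      det (mat (p + 2 * k) (p + 2 * k) (\<lambda>(i, j). l i j))"
  proof (rule det_doubled_block_dvd)
    fix i j assume ij: "i < k" "j < k"
    show "l (p + i) (p + k + j) = 0 \<and> l (p + k + i) (p + j) = 0"
      using cross[OF ij] cross[OF ij(2,1)] sym by simp
    show "l (p + k + i) (p + k + j) = l (p + i) (p + j)"
      using path[of p i j] path[of "p + k" i j] ij by simp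
  next
    fix i j assume ij: "i < k" "j < p"
    show "l (p + k + i) j = l (p + i) j"
      using outer[of p i j] outer[of "p + k" i j] ij by simp
  qed
  also have "mat k k (\<lambda>(i, j). l (p + i) (p + j)) = chain_mat ds"
    by (rule eq_matI) (auto simp: chain_mat_def path k_def[symmetric])
  also have "mat (p + 2 * k) (p + 2 * k) (\<lambda>(i, j). l i j) = reduced_laplacian ?n ?E"
    by (rule eq_matI) (auto simp: reduced_laplacian_def l_def)
  finally have dvd: "continuant ds dvd int (tau {..?n} ?E)"
    by (simp add: det_chain_mat matrix_tree[OF chain_edges_subset])
  have sg: "simple_graph {..?n} ?E" using chain_edges_subset by (auto simp: simple_graph_def)
  then have "tau {..?n} ?E \<in> tau_values n" unfolding tau_values_def using n by force
  moreover have "tau {..?n} ?E \<le> n ^ n" using tau_le_power[OF sg, of 0] n by simp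
  ultimately show ?thesis using dvd tau_chain_pos by blast
qed

subsection \<open>Divisors and counting\<close>

lemma card_divisors_mult_le:
  fixes a b :: nat
  assumes "a > 0" "b > 0"
  shows "card {d. d dvd a * b} \<le> card {d. d dvd a} * card {d. d dvd b}"
proof -
  let ?AB = "{d. d dvd a} \<times> {d. d dvd b}"
  have fin: "finite ?AB" using assms by (intro finite_cartesian_product) auto
  have "{d. d dvd a * b} \<subseteq> (\<lambda>(x, y). x * y) ` ?AB"
    by (auto elim!: dvd_productE)
  then have "card {d. d dvd a * b} \<le> card ?AB"
    using fin by (meson card_image_le card_mono finite_imageI le_trans)
  then show ?thesis by (simp add: card_cartesian_product)
qed

lemma card_divisors_prod_prime_powers_le:
  fixes e :: "nat \<Rightarrow> nat"
  assumes "finite P" "\<And>p. p \<in> P \<Longrightarrow> prime p"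
  shows "card {d. d dvd (\<Prod>p\<in>P. p ^ e p)} \<le> (\<Prod>p\<in>P. e p + 1)"
  using assms
proof (induction P rule: finite_induct)
  case (insert p P)
  have p: "prime p" using insert by simp
  have "{d. d dvd p ^ e p} = (\<lambda>i. p ^ i) ` {..e p}"
    using divides_primepow_nat[OF p] by auto
  then have pe: "card {d. d dvd p ^ e p} \<le> e p + 1"
    using card_image_le[of "{..e p}" "\<lambda>i. p ^ i"] by simp
  have "0 < (\<Prod>p\<in>P. p ^ e p)" using insert by (intro prod_pos) (auto simp: prime_gt_0_nat)
  then have "card {d. d dvd p ^ e p * (\<Prod>p\<in>P. p ^ e p)}
      \<le> card {d. d dvd p ^ e p} * card {d. d dvd (\<Prod>p\<in>P. p ^ e p)}"
    using p by (intro card_divisors_mult_le) (auto simp: prime_gt_0_nat)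
  also have "\<dots> \<le> (e p + 1) * (\<Prod>p\<in>P. e p + 1)"
    using pe insert by (intro mult_le_mono) auto
  finally show ?case using insert by simp
qed simp

text \<open>Primes are split at \<open>y\<close>. There are at most \<open>y\<close> small ones,
  each with exponent at most \<open>n\<^sup>2\<close>. The exponents of the large ones sum to at
  most \<open>2 * n\<close>, because \<open>N \<le> y ^ (2 * n)\<close>, and
  \<open>e + 1 \<le> 2 ^ e\<close>. For \<open>y\<close> near the square root of \<open>n\<close>
  the bound is \<open>exp (O n)\<close>.\<close>

lemma card_divisors_le:
  fixes N n y :: nat
  assumes N: "0 < N" "N \<le> n ^ n" and y: "2 \<le> y" "n \<le> y\<^sup>2"
  shows "card {d. d dvd N} \<le> (n\<^sup>2 + 1) ^ y * 4 ^ n"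
proof -
  define e where "e p = multiplicity p N" for p
  let ?P = "prime_factors N"
  let ?S = "{p \<in> ?P. p < y}" and ?L = "{p \<in> ?P. y \<le> p}"
  have P: "?P = ?S \<union> ?L" "?S \<inter> ?L = {}" by auto
  have prime: "prime p" if "p \<in> ?P" for p using that by auto
  have N_eq: "N = (\<Prod>p\<in>?P. p ^ e p)"
    using prod_prime_factors[of N] N by (simp add: e_def)
  have "2 ^ e p \<le> (2::nat) ^ n\<^sup>2" if p: "p \<in> ?P" for p
  proof -
    have "2 ^ e p \<le> p ^ e p" using prime_ge_2_nat[OF prime[OF p]] by (rule power_mono) simp
    also have "\<dots> \<le> N" using N multiplicity_dvd[of p N] by (intro dvd_imp_le) (auto simp: e_def)
    also have "\<dots> \<le> (2 ^ n) ^ n"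
      using N(2) by (rule order_trans) (simp add: power_mono less_imp_le)
    finally show ?thesis by (simp add: power_mult power2_eq_square)
  qed
  then have e_le: "e p \<le> n\<^sup>2" if "p \<in> ?P" for p using that by (simp add: power_increasing_iff)
  have "(\<Prod>p\<in>?S. e p + 1) \<le> (\<Prod>p\<in>?S. n\<^sup>2 + 1)"
    using e_le by (intro prod_mono) auto
  also have "\<dots> \<le> (n\<^sup>2 + 1) ^ y"
  proof -
    have "card ?S \<le> card {..<y}" by (intro card_mono) auto
    then show ?thesis by (simp add: power_increasing)
  qed
  finally have small: "(\<Prod>p\<in>?S. e p + 1) \<le> (n\<^sup>2 + 1) ^ y" .
  have "y ^ (\<Sum>p\<in>?L. e p) = (\<Prod>p\<in>?L. y ^ e p)" by (simp add: power_sum)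
  also have "\<dots> \<le> (\<Prod>p\<in>?L. p ^ e p)" by (intro prod_mono) (auto intro: power_mono)
  also have "\<dots> \<le> N"
  proof (rule dvd_imp_le)
    show "(\<Prod>p\<in>?L. p ^ e p) dvd N" by (subst N_eq) (intro prod_dvd_prod_subset, auto)
  qed (rule N)
  also have "\<dots> \<le> (y\<^sup>2) ^ n" using N(2) y(2) by (meson order_trans power_mono zero_le)
  also have "\<dots> = y ^ (2 * n)" by (simp add: power_mult)
  finally have sum_le: "(\<Sum>p\<in>?L. e p) \<le> 2 * n" using y by (simp add: power_increasing_iff)
  have "(\<Prod>p\<in>?L. e p + 1) \<le> (\<Prod>p\<in>?L. 2 ^ e p)"
    by (intro prod_mono) (auto simp: Suc_le_eq)
  also have "\<dots> = 2 ^ (\<Sum>p\<in>?L. e p)" by (simp add: power_sum)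
  also have "\<dots> \<le> 2 ^ (2 * n)" using sum_le by (intro power_increasing) auto
  finally have large: "(\<Prod>p\<in>?L. e p + 1) \<le> 4 ^ n" by (simp add: power_mult)
  have "card {d. d dvd N} \<le> (\<Prod>p\<in>?P. e p + 1)"
    by (subst N_eq) (rule card_divisors_prod_prime_powers_le, auto)
  also have "\<dots> = (\<Prod>p\<in>?S. e p + 1) * (\<Prod>p\<in>?L. e p + 1)"
    by (subst P(1), rule prod.union_disjoint) auto
  also have "\<dots> \<le> (n\<^sup>2 + 1) ^ y * 4 ^ n" by (rule mult_le_mono[OF small large])
  finally show ?thesis .
qed

text \<open>Lists of \<open>k\<close> entries from \<open>m\<close> values inject into pairs of
  divisors of positive elements of \<open>tau_values n\<close>.\<close>

lemma power_le_card_tau_values: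
  assumes n: "2 * k + m + 2 \<le> n" and y: "2 \<le> y" "n \<le> y\<^sup>2"
  shows "m ^ k \<le> (card (tau_values n) * ((n\<^sup>2 + 1) ^ y * 4 ^ n))\<^sup>2"
proof -
  define T where "T = {t \<in> tau_values n. 0 < t \<and> t \<le> n ^ n}"
  define D where "D = (\<Union>t\<in>T. {d. d dvd t})"
  let ?b = "(n\<^sup>2 + 1) ^ y * 4 ^ n"
  have finT: "finite T" using finite_tau_values by (simp add: T_def)
  have finD: "finite D" using finT by (auto simp: D_def T_def)
  have "card D \<le> (\<Sum>t\<in>T. card {d. d dvd t})"
    unfolding D_def by (rule card_UN_le[OF finT])
  also have "\<dots> \<le> card T * ?b"
    using sum_bounded_above[of T "\<lambda>t. card {d. d dvd t}" ?b] card_divisors_le[OF _ _ y]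
    by (simp add: T_def)
  also have "\<dots> \<le> card (tau_values n) * ?b"
    by (intro mult_right_mono card_mono finite_tau_values) (auto simp: T_def)
  finally have cardD: "card D \<le> card (tau_values n) * ?b" .
  let ?X = "{xs. set xs \<subseteq> {3..int m + 2} \<and> length xs = k}"
  let ?g = "\<lambda>xs. (nat (continuant xs), nat (continuant (tl xs)))"
  \<comment> \<open>Allowing lengths below \<open>k\<close> covers the tail as well, which gets its
    own doubled path graph on \<open>n\<close> vertices.\<close>
  have in_D: "nat (continuant ds) \<in> D" if "set ds \<subseteq> {3..int m + 2}" "length ds \<le> k" for ds
  proof -
    have "\<forall>d\<in>set ds. 3 \<le> d \<and> d + 2 * int (length ds) \<le> int n" "2 * length ds < n"
      using that n by auto
    then obtain t where t: "t \<in> tau_values n" "continuant ds dvd int t" "0 < t" "t \<le> n ^ n"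
      using continuant_dvd_tau by blast
    have "\<forall>d\<in>set ds. 2 \<le> d" using that by auto
    then have "0 < continuant ds" using continuant_bounds by blast
    then have "nat (continuant ds) dvd t" using t(2) by (simp add: nat_dvd_iff)
    then show ?thesis using t by (auto simp: D_def T_def)
  qed
  have "inj_on ?g ?X"
  proof (rule inj_onI)
    fix xs ys assume xs: "xs \<in> ?X" and ys: "ys \<in> ?X" and eq: "?g xs = ?g ys"
    have ge: "\<forall>d\<in>set zs. 2 \<le> d" "\<forall>d\<in>set (tl zs). 2 \<le> d" if "zs \<in> ?X" for zs
      using that by (cases zs; force)+
    have pos: "0 < continuant zs" "0 < continuant (tl zs)" if "zs \<in> ?X" for zs
      using continuant_bounds ge[OF that] by blast+
    have "continuant xs = continuant ys" "continuant (tl xs) = continuant (tl ys)"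
      using eq pos[OF xs] pos[OF ys] by auto
    then show "xs = ys" using continuant_inj ge(1)[OF xs] ge(1)[OF ys] xs ys by auto
  qed
  moreover have "?g ` ?X \<subseteq> D \<times> D"
  proof
    fix z assume "z \<in> ?g ` ?X"
    then obtain xs where xs: "set xs \<subseteq> {3..int m + 2}" "length xs = k" and z: "z = ?g xs" by auto
    have "set (tl xs) \<subseteq> set xs" by (cases xs) auto
    then show "z \<in> D \<times> D" using in_D[of xs] in_D[of "tl xs"] xs z by auto
  qed
  ultimately have "card ?X \<le> card (D \<times> D)"
    using finD by (intro card_inj_on_le) auto
  also have "\<dots> = (card D)\<^sup>2" by (simp add: card_cartesian_product power2_eq_square)
  also have "\<dots> \<le> (card (tau_values n) * ?b)\<^sup>2" using cardD by (rule power_mono) simp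
  also have "card ?X = m ^ k" by (simp add: card_lists_length_eq)
  finally show ?thesis .
qed

section \<open>Asymptotics and choice of parameters\<close>

text \<open>The numerator is the lower bound for twice the logarithm of the count, with
  \<open>k\<close> near \<open>(1 - a) * x / 2\<close>, \<open>m \<ge> a * x - 2\<close> and
  \<open>y \<le> sqrt x + 1\<close>. Only its first term has order \<open>x * ln x\<close>.\<close>

lemma log_count_ratio_tendsto:
  fixes a :: real
  assumes "0 < a" "a < 1"
  shows "((\<lambda>x. (((1 - a) * x / 2 - 1) * ln (a * x - 2) - 2 * (sqrt x + 1) * ln (x\<^sup>2 + 1)
    - 2 * x * ln 4) / (x * ln x)) \<longlongrightarrow> (1 - a) / 2) at_top"
  using assms by real_asymp


theorem theorem1p1:
  fixes c :: real
  assumes "0 < c" and "c < 1 / 4"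
  shows "\<exists>n0 :: nat. \<forall>n\<ge>n0. real (card (tau_values n)) \<ge> exp (c * real n * ln (real n))"
proof -
  \<comment> \<open>About \<open>a * n\<close> vertices stay outside the two paths. This choice
    makes \<open>(1 - a) / 2\<close> equal to \<open>c + 1 / 4\<close>, which exceeds
    \<open>2 * c\<close>.\<close>
  define a where "a = (1 - 4 * c) / 2"
  have a: "0 < a" "a < 1" "2 * c < (1 - a) / 2" using assms by (auto simp: a_def field_simps)
  let ?r = "\<lambda>x. ((1 - a) * x / 2 - 1) * ln (a * x - 2) - 2 * (sqrt x + 1) * ln (x\<^sup>2 + 1) - 2 * x * ln 4"
  have "((\<lambda>n. ?r (real n) / (real n * ln (real n))) \<longlongrightarrow> (1 - a) / 2) sequentially"
    by (rule filterlim_compose[OF log_count_ratio_tendsto[OF a(1,2)] filterlim_real_sequentially])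
  then have "\<forall>\<^sub>F n in sequentially. 2 * c < ?r (real n) / (real n * ln (real n))"
    using a(3) by (rule order_tendstoD(1))
  \<comment> \<open>This makes \<open>a * n - 2\<close> at least 1, so \<open>m\<close> is positive
    and the logarithms are nonnegative.\<close>
  moreover have "\<forall>\<^sub>F n in sequentially. 3 / a \<le> real n"
    by (rule eventually_sequentiallyI[of "nat \<lceil>3 / a\<rceil>"]) linarith
  ultimately have "\<forall>\<^sub>F n in sequentially. exp (c * real n * ln (real n)) \<le> real (card (tau_values n))"
    using eventually_ge_at_top[of 4]
  proof eventually_elim
    case (elim n)
    have an: "3 \<le> a * real n" using elim(2) a(1) by (simp add: field_simps)
    have "0 < real n * ln (real n)" using elim(3) by simp
    then have r: "2 * c * (real n * ln (real n)) < ?r (real n)"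
      using elim(1) by (simp only: pos_less_divide_eq)
    define k where "k = nat \<lfloor>(1 - a) * real n / 2\<rfloor>"
    define m where "m = n - 2 * k - 2"
    define y where "y = nat \<lceil>sqrt (real n)\<rceil>"
    have k0: "0 \<le> (1 - a) * real n / 2" using a by simp
    have k: "real k \<le> (1 - a) * real n / 2" "(1 - a) * real n / 2 - 1 \<le> real k"
      using k0 unfolding k_def by linarith+
    have "2 * real k + a * real n \<le> real n" using k(1) by (simp add: field_simps)
    then have "real (2 * k + 2) \<le> real n" using an by simp
    then have km: "2 * k + m + 2 = n" by (simp add: m_def)
    have "a * real n - 2 \<le> real m"
      using \<open>2 * real k + a * real n \<le> real n\<close> km by linarith
    have "sqrt (real 4) \<le> sqrt (real n)" using elim(3) by (intro real_sqrt_le_mono) simp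
    then have sqrt_ge: "2 \<le> sqrt (real n)" by simp
    have y: "sqrt (real n) \<le> real y" "real y \<le> sqrt (real n) + 1"
      using sqrt_ge unfolding y_def by linarith+
    have y2: "2 \<le> y" using y(1) sqrt_ge by linarith
    have "real n \<le> (real y)\<^sup>2" using y(1) by (rule sqrt_le_D)
    then have "n \<le> y\<^sup>2" by (simp flip: of_nat_power)
    let ?X = "real (card (tau_values n))"
    have "m ^ k \<le> (card (tau_values n) * ((n\<^sup>2 + 1) ^ y * 4 ^ n))\<^sup>2"
      using km y2 \<open>n \<le> y\<^sup>2\<close> by (intro power_le_card_tau_values) auto
    then have "real (m ^ k) \<le> real ((card (tau_values n) * ((n\<^sup>2 + 1) ^ y * 4 ^ n))\<^sup>2)"
      by (rule of_nat_mono)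
    then have le: "real m ^ k \<le> (?X * (((real n)\<^sup>2 + 1) ^ y * 4 ^ n))\<^sup>2" by (simp add: add_ac)
    have m: "1 \<le> real m" using \<open>a * real n - 2 \<le> real m\<close> an by linarith
    then have "0 < real m ^ k" by simp
    \<comment> \<open>Taking logarithms needs a nonzero count.\<close>
    with le have X: "0 < ?X" by (cases "?X = 0") auto
    have n1: "0 < (real n)\<^sup>2 + 1" by (simp add: add_nonneg_pos)
    have "((1 - a) * real n / 2 - 1) * ln (a * real n - 2) \<le> real k * ln (a * real n - 2)"
      using k(2) an by (intro mult_right_mono) auto
    also have "\<dots> \<le> real k * ln (real m)"
      using \<open>a * real n - 2 \<le> real m\<close> an by (intro mult_left_mono) auto
    also have "\<dots> = ln (real m ^ k)" using m by (simp add: ln_realpow)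
    also have "\<dots> \<le> ln ((?X * (((real n)\<^sup>2 + 1) ^ y * 4 ^ n))\<^sup>2)"
      using le \<open>0 < real m ^ k\<close> by (intro ln_mono) auto
    also have "\<dots> = 2 * (ln ?X + (real y * ln ((real n)\<^sup>2 + 1) + real n * ln 4))"
      using X n1 by (simp add: ln_realpow ln_mult)
    finally have "((1 - a) * real n / 2 - 1) * ln (a * real n - 2) \<le>
      2 * ln ?X + 2 * (real y * ln ((real n)\<^sup>2 + 1)) + 2 * real n * ln 4" by (simp add: algebra_simps)
    moreover have "real y * ln ((real n)\<^sup>2 + 1) \<le> (sqrt (real n) + 1) * ln ((real n)\<^sup>2 + 1)"
      using y(2) by (intro mult_right_mono) auto
    \<comment> \<open>The square in the counting bound is the factor 2 that \<open>2 * c\<close> in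
      \<open>r\<close> compensates.\<close>
    ultimately have "c * real n * ln (real n) \<le> ln ?X" using r by (simp add: algebra_simps)
    then show ?case using X by (simp add: ln_ge_iff)
  qed
  then show ?thesis by (simp add: eventually_sequentially)
qed

end
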